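(* Let $\underline{M}\in\mathfrak{M}\setminus\{RL^{\infty}\}$. Then the function $\Theta_{\underline{M}}:U\to\mathbb{R}$, $$\Theta_{\underline{M}}(\alpha,\beta)=1-\beta+\sum_{k=1}^{\infty}(-1)^{k}\left(\frac{1-\alpha}{\beta}\right)^{k}\left(\frac{\alpha}{\beta}\right)^{\overline{m}_k},$$ has the property that for every $(\alpha,\beta)\in U$, if $K(\alpha,\beta)=\underline{M}$ then $\Theta_{\underline{M}}(\alpha,\beta)=0$. Moreover, $\Theta_{\underline{M}}$ can also be written as $$\Theta_{\underline{M}}(\alpha,\beta)=1-\beta+\sum_{k=1}^{\infty}\left(\frac{\alpha-1}{\beta}\right)^{k}\left(\frac{\alpha}{\beta}\right)^{\overline{m}_k},$$ where $m_1=\overline{m}_1>0$ and $\overline{m}_k\le\overline{m}_{k+1}\le\overline{m}_k+\overline{m}_1$ for $k=0,1,2,\dots$ (with $\overline{m}_0=0$). If $\underline{M}=K(\alpha,\beta)\in\mathfrak{M}_{R\infty}$, then there exists $n$ such that $\overline{m}_{k+1}=\overline{m}_k$ for all $k\ge n$.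
   Context: Let $U=\{(\alpha,\beta): 1/2<\beta\le 1,\ 1-\beta<\alpha<\beta\}$. For $(\alpha,\beta)\in U$ the skew tent map $T_{\alpha,\beta}:[0,1]\to[0,1]$ is $T_{\alpha,\beta}(x)=\frac{\beta}{\alpha}x$ for $0\le x\le\alpha$ and $T_{\alpha,\beta}(x)=\frac{\beta}{1-\alpha}(1-x)$ for $\alpha<x\le1$. The extended itinerary of $x\in[0,1]$ is the sequence indexed by $n\ge 0$ whose $n$-th entry is $L$, $C$ or $R$ according to whether $T_{\alpha,\beta}^n(x)<\alpha$, $=\alpha$ or $>\alpha$. The itinerary $\underline{I}_{\alpha,\beta}(x)$ is the extended itinerary if it contains no $C$; otherwise it is the finite string obtained by stopping at (and including) the first $C$. The kneading sequence is $K(\alpha,\beta)=\underline{I}_{\alpha,\beta}(\beta)$. $\mathfrak{M}$ is the set of all kneading sequences $K(1/2,\beta)$, $\beta\in(1/2,1]$ (it also contains $K(\alpha,\beta)$ for every $(\alpha,\beta)\in U$). $\mathfrak{M}_{R\infty}$ is the set of those $\underline{M}\in\mathfrak{M}$ of the form $A_0A_1\dots A_{n-1}R^{\infty}$. For $\underline{M}\in\mathfrak{M}$ define the infinite $\{L,R\}$-sequence $\underline{M}^-$: if $\underline{M}$ is infinite (contains no $C$), $\underline{M}^-=\underline{M}$; if $\underline{M}=A_0\dots A_{n-1}C$ with $A_i\in\{L,R\}$, then $\underline{M}^-=(A_0\dots A_{n-1}L)^{\infty}$ when the number of $R$'s in $A_0\dots A_{n-1}$ is even, and $\underline{M}^-=(A_0\dots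 A_{n-1}R)^{\infty}$ when it is odd. For $\underline{M}\in\mathfrak{M}\setminus\{RL^{\infty}\}$ the sequence $\underline{M}^-$ starts with $R$ and contains infinitely many $R$'s, so it can be written uniquely as $\underline{M}^-=R\,L^{m_1}R\,L^{m_2}R\,L^{m_3}R\dots$ with integers $m_i\ge0$; put $\overline{m}_k=m_1+\dots+m_k$. *)

theory Defs
  imports Complex_Main "HOL-Library.Infinite_Set" "HOL-Library.Omega_Words_Fun"
begin

definition U :: "(real \<times> real) set" where
  "U = {(\<alpha>, \<beta>). 1/2 < \<beta> \<and> \<beta> \<le> 1 \<and> 1 - \<beta> < \<alpha> \<and> \<alpha> < \<beta>}"

(* Extended to all of the real line; it maps [0,1] into itself for parameters in U. *)
definition skew_tent :: "real \<Rightarrow> real \<Rightarrow> real \<Rightarrow> real" where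
  "skew_tent \<alpha> \<beta> x = (if x \<le> \<alpha> then \<beta> / \<alpha> * x else \<beta> / (1 - \<alpha>) * (1 - x))"

datatype symbol = L | C | R

definition ext_itinerary :: "real \<Rightarrow> real \<Rightarrow> real \<Rightarrow> symbol word" where
  "ext_itinerary \<alpha> \<beta> x n =
     (let y = (skew_tent \<alpha> \<beta> ^^ n) x in if y < \<alpha> then L else if y = \<alpha> then C else R)"

datatype symbol_seq = FinSeq "symbol list" | InfSeq "symbol word"

definition itinerary :: "real \<Rightarrow> real \<Rightarrow> real \<Rightarrow> symbol_seq" where
  "itinerary \<alpha> \<beta> x =
     (let s = ext_itinerary \<alpha> \<beta> x in
      if C \<in> range s then FinSeq (map s [0..<Suc (LEAST n. s n = C)]) else InfSeq s)"

definition kneading :: "real \<Rightarrow> real \<Rightarrow> symbol_seq" where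
  "kneading \<alpha> \<beta> = itinerary \<alpha> \<beta> \<beta>"

definition kneading_seqs :: "symbol_seq set" where
  "kneading_seqs = {kneading (1/2) \<beta> | \<beta>. 1/2 < \<beta> \<and> \<beta> \<le> 1}"

definition kneading_seqs_Rinf :: "symbol_seq set" where
  "kneading_seqs_Rinf =
     {M \<in> kneading_seqs. \<exists>A. set A \<subseteq> {L, R} \<and> M = InfSeq (A \<frown> [R]\<^sup>\<omega>)}"

(* A finite kneading sequence has the form A @ [C], so butlast recovers A. *)
fun minus_seq :: "symbol_seq \<Rightarrow> symbol word" where
  "minus_seq (InfSeq s) = s"
| "minus_seq (FinSeq xs) =
     (let A = butlast xs in (A @ [if even (count_list A R) then L else R])\<^sup>\<omega>)"

(* For s = R L^m(1) R L^m(2) R ... this is m(k), k \<ge> 1: the number of letters between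
   the k-th and the (k+1)-st R (enumerate counts from 0). The value at 0 is 0.
   See the lemma L_run_expansion. *)
definition L_run :: "symbol word \<Rightarrow> nat \<Rightarrow> nat" where
  "L_run s k = enumerate {n. s n = R} k - enumerate {n. s n = R} (k - 1) - 1"

lemma L_run_expansion:
  assumes LR: "range s \<subseteq> {L, R}" and R0: "s 0 = R" and inf: "infinite {n. s n = R}"
  shows "s = concat (map (\<lambda>i. R # replicate (L_run s i) L) [1..<Suc k])
               \<frown> suffix (enumerate {n. s n = R} k) s"
proof -
  let ?e = "enumerate {n. s n = R}"
  have e0: "?e 0 = 0"
    using R0 by (simp add: enumerate_0 Least_eq_0)
  have "concat (map (\<lambda>i. R # replicate (L_run s i) L) [1..<Suc k]) = prefix (?e k) s"
  proof (induction k)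
    case 0
    then show ?case by (simp add: e0)
  next
    case (Suc k)
    have lt: "?e k < ?e (Suc k)" by (rule enumerate_step[OF inf])
    have "s (?e k) = R" using enumerate_in_set[OF inf, of k] by simp
    moreover have "s j = L" if "?e k < j" "j < ?e (Suc k)" for j
    proof (rule ccontr)
      assume "s j \<noteq> L"
      then have "s j = R" using LR by (metis insertE rangeI singletonD subsetD)
      then obtain i where i: "?e i = j"
        using enumerate_Ex[OF inf, of j] by auto
      with that inf show False by auto
    qed
    ultimately have "R # replicate (L_run s (Suc k)) L = s [?e k \<rightarrow> ?e (Suc k)]"
      using lt by (intro nth_equalityI)
        (auto simp: L_run_def subsequence_def nth_Cons split: nat.split)
    then show ?case
      using Suc subsequence_append[of s "?e k" "?e (Suc k) - ?e k"] lt by simp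
  qed
  then show ?thesis by (simp add: prefix_suffix[symmetric])
qed

definition mbar :: "symbol_seq \<Rightarrow> nat \<Rightarrow> nat" where
  "mbar M k = (\<Sum>i=1..k. L_run (minus_seq M) i)"

definition Theta_term :: "symbol_seq \<Rightarrow> real \<Rightarrow> real \<Rightarrow> nat \<Rightarrow> real" where
  "Theta_term M \<alpha> \<beta> k = (-1) ^ k * ((1 - \<alpha>) / \<beta>) ^ k * (\<alpha> / \<beta>) ^ mbar M k"

definition Theta :: "symbol_seq \<Rightarrow> real \<Rightarrow> real \<Rightarrow> real" where
  "Theta M \<alpha> \<beta> = 1 - \<beta> + (\<Sum>k. Theta_term M \<alpha> \<beta> (Suc k))"

end

theory Submission
  imports Defs
begin

text \<open>
  Write \<open>x j\<close> for the orbit of the critical value \<open>\<beta>\<close> and \<open>s\<close> for the word \<open>minus_seq M\<close>, where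
  \<open>M\<close> is the kneading sequence of the parameters. Each letter of \<open>s\<close> names a branch of the map
  that sends \<open>x j\<close> to \<open>x (j + 1)\<close>: where the itinerary has no \<open>C\<close> this is its meaning, and once
  the orbit hits the turning point it is periodic, and at the turning point both branches apply
  (lemma \<open>branch_coding_kneading\<close>). Hence the orbit can be read backwards: with
  \<open>a = (1 - \<alpha>) / \<beta>\<close> and \<open>b = \<alpha> / \<beta>\<close> the inverse branches are \<open>y \<mapsto> b * y\<close> for \<open>L\<close> and
  \<open>y \<mapsto> 1 - a * y\<close> for \<open>R\<close>. If \<open>s\<close> consists of the blocks \<open>R\<close> followed by \<open>m k\<close> letters \<open>L\<close>,
  this gives
    \<open>\<beta> = 1 - a * b ^ m 1 * (1 - a * b ^ m 2 * (1 - \<dots>))\<close>,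
  which is the vanishing of \<open>Theta\<close> once expanded; the remainder tends to \<open>0\<close> since
  \<open>0 < a < 1\<close> and \<open>0 < b < 1\<close> on \<open>U\<close> (lemma \<open>Theta_kneading_eq_0\<close>).

  The properties of the \<open>m k\<close> concern \<open>M\<close> alone, so they can be read off from any parameters
  that realise \<open>M\<close>; the symmetric tent map serves. The bound \<open>m k \<le> m 1\<close> comes from the order of
  the line: no orbit point exceeds \<open>\<beta>\<close>, so no point reached through the branch \<open>R\<close> is below
  \<open>x 1\<close>, and a point starting higher leaves the left branch no later. The only delicate case is a
  tie at the turning point; it is decided by the fact that all visits to the turning point carry
  the same letter (lemma \<open>L_run_le_first\<close>). There are infinitely many letters \<open>R\<close>, so that the
  runs exist, because \<open>\<beta> < 1\<close> keeps the orbit off the fixed point \<open>0\<close> and the left branch is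
  expanding.
\<close>

section \<open>The orbit of the critical value\<close>

abbreviation crit_orbit :: "real \<Rightarrow> real \<Rightarrow> nat \<Rightarrow> real" where
  "crit_orbit \<alpha> \<beta> j \<equiv> (skew_tent \<alpha> \<beta> ^^ j) \<beta>"

lemma U_bounds:
  assumes "(\<alpha>, \<beta>) \<in> U"
  shows "0 < \<alpha>" "\<alpha> < 1" "\<alpha> < \<beta>" "\<beta> \<le> 1" "0 < \<beta>" "1 - \<alpha> < \<beta>"
  using assms by (auto simp: U_def)

lemma skew_tent_right:
  assumes "(\<alpha>, \<beta>) \<in> U" "\<alpha> \<le> x"
  shows "skew_tent \<alpha> \<beta> x = \<beta> / (1 - \<alpha>) * (1 - x)"
  using assms U_bounds[OF assms(1)] by (cases "x = \<alpha>") (auto simp: skew_tent_def)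

lemma skew_tent_range:
  assumes "(\<alpha>, \<beta>) \<in> U" "0 \<le> x" "x \<le> 1"
  shows "0 \<le> skew_tent \<alpha> \<beta> x" "skew_tent \<alpha> \<beta> x \<le> \<beta>"
  using assms(2,3) U_bounds[OF assms(1)] by (auto simp: skew_tent_def field_simps)

lemma skew_tent_pos:
  assumes "(\<alpha>, \<beta>) \<in> U" "0 < x" "x < 1"
  shows "0 < skew_tent \<alpha> \<beta> x"
  using assms(2,3) U_bounds[OF assms(1)] by (auto simp: skew_tent_def)

lemma crit_orbit_range:
  assumes "(\<alpha>, \<beta>) \<in> U"
  shows "0 \<le> crit_orbit \<alpha> \<beta> j \<and> crit_orbit \<alpha> \<beta> j \<le> \<beta>"
proof (induction j)
  case 0
  then show ?case using U_bounds[OF assms] by simp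
next
  case (Suc j)
  then show ?case using skew_tent_range[OF assms, of "crit_orbit \<alpha> \<beta> j"] U_bounds[OF assms] by simp
qed

lemma crit_orbit_pos:
  assumes "(\<alpha>, \<beta>) \<in> U" "\<beta> < 1"
  shows "0 < crit_orbit \<alpha> \<beta> j"
proof (induction j)
  case 0
  then show ?case using U_bounds[OF assms(1)] by simp
next
  case (Suc j)
  then show ?case
    using skew_tent_pos[OF assms(1), of "crit_orbit \<alpha> \<beta> j"]
      crit_orbit_range[OF assms(1), of j] assms(2) by simp
qed

lemma crit_orbit_1_less:
  assumes "(\<alpha>, \<beta>) \<in> U"
  shows "crit_orbit \<alpha> \<beta> 1 < \<alpha>"
proof -
  note b = U_bounds[OF assms]
  have "0 < (\<alpha> - (1 - \<beta>)) * (\<beta> - \<alpha>)" using b by simp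
  then have "\<beta> * (1 - \<beta>) < \<alpha> * (1 - \<alpha>)" by (simp add: algebra_simps)
  then have "\<beta> / (1 - \<alpha>) * (1 - \<beta>) < \<alpha>" using b by (simp add: field_simps)
  then show ?thesis using b skew_tent_right[OF assms, of \<beta>] by simp
qed

text \<open>At full height \<open>\<beta> = 1\<close> the critical value is mapped to the fixed point \<open>0\<close>; removing
  the sequence \<open>R L\<^sup>\<infinity>\<close> therefore removes exactly this height.\<close>

lemma kneading_full_height:
  assumes "(\<alpha>, 1) \<in> U"
  shows "kneading \<alpha> 1 = InfSeq ([R] \<frown> [L]\<^sup>\<omega>)"
proof -
  note b = U_bounds[OF assms]
  have orb: "crit_orbit \<alpha> 1 (Suc j) = 0" for j
  proof (induction j)
    case 0
    then show ?case using b by (simp add: skew_tent_def)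
  next
    case (Suc j)
    then show ?case using b by (simp add: skew_tent_def)
  qed
  have "ext_itinerary \<alpha> 1 1 j = ([R] \<frown> [L]\<^sup>\<omega>) j" for j
    using orb b by (cases j) (auto simp: ext_itinerary_def conc_def iter_def Let_def)
  moreover have "([R] \<frown> [L]\<^sup>\<omega>) j \<noteq> C" for j
    by (auto simp: conc_def iter_def)
  ultimately have "ext_itinerary \<alpha> 1 1 = ([R] \<frown> [L]\<^sup>\<omega>)" "C \<notin> range ([R] \<frown> [L]\<^sup>\<omega>)"
    by (auto simp: fun_eq_iff image_iff dest: sym)
  then show ?thesis by (simp add: kneading_def itinerary_def)
qed

section \<open>Letters as branches of the map\<close>

text \<open>The word \<open>s\<close> assigns to each orbit point a branch whose closed domain contains it. The
  last condition makes the choice consistent at the turning point, where both branches apply.\<close>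

definition branch_coding :: "real \<Rightarrow> real \<Rightarrow> symbol word \<Rightarrow> bool" where
  "branch_coding \<alpha> \<beta> s \<longleftrightarrow>
     (\<forall>j. s j = L \<and> crit_orbit \<alpha> \<beta> j \<le> \<alpha> \<or> s j = R \<and> \<alpha> \<le> crit_orbit \<alpha> \<beta> j) \<and>
     (\<forall>i j. crit_orbit \<alpha> \<beta> i = \<alpha> \<longrightarrow> crit_orbit \<alpha> \<beta> j = \<alpha> \<longrightarrow> s i = s j)"

text \<open>If the orbit first meets the turning point at time \<open>p - 1\<close>, it returns to \<open>\<beta>\<close> at time \<open>p\<close>, so
  it has the same period \<open>p\<close> as the word \<open>minus_seq (kneading \<alpha> \<beta>)\<close>; the times of the visits are then
  those congruent to \<open>p - 1\<close>.\<close>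

lemma branch_coding_kneading:
  assumes U: "(\<alpha>, \<beta>) \<in> U"
  shows "branch_coding \<alpha> \<beta> (minus_seq (kneading \<alpha> \<beta>))"
proof (cases "C \<in> range (ext_itinerary \<alpha> \<beta> \<beta>)")
  case False
  then have eq: "minus_seq (kneading \<alpha> \<beta>) = ext_itinerary \<alpha> \<beta> \<beta>"
    by (simp add: kneading_def itinerary_def)
  have "ext_itinerary \<alpha> \<beta> \<beta> j \<noteq> C" for j using False by (metis rangeI)
  then have "crit_orbit \<alpha> \<beta> j \<noteq> \<alpha>" for j
    unfolding ext_itinerary_def Let_def by (metis less_irrefl)
  then show ?thesis unfolding eq branch_coding_def
    by (auto simp: ext_itinerary_def Let_def)
next
  case True
  define x where "x = crit_orbit \<alpha> \<beta>"
  define t where "t = ext_itinerary \<alpha> \<beta> \<beta>"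
  define n where "n = (LEAST n. t n = C)"
  define A where "A = map t [0..<n]"
  define c where "c = (if even (count_list A R) then L else R)"
  have t: "t j = (if x j < \<alpha> then L else if x j = \<alpha> then C else R)" for j
    by (simp add: t_def x_def ext_itinerary_def Let_def)
  obtain i where "t i = C" using True unfolding t_def by (metis rangeE)
  then have "t n = C" unfolding n_def by (rule LeastI)
  then have xn: "x n = \<alpha>" by (auto simp: t split: if_splits)
  have before: "t j \<noteq> C" if "j < n" for j
    using not_less_Least[OF that[unfolded n_def]] .
  have word: "minus_seq (kneading \<alpha> \<beta>) = (A @ [c])\<^sup>\<omega>"
    using True unfolding kneading_def itinerary_def
    by (simp add: t_def[symmetric] n_def[symmetric] A_def[symmetric] c_def)
  have s: "minus_seq (kneading \<alpha> \<beta>) j = (if j mod Suc n < n then t (j mod Suc n) else c)"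
    for j
  proof -
    have "j mod Suc n \<le> n" using mod_less_divisor[of "Suc n" j] by linarith
    then show "minus_seq (kneading \<alpha> \<beta>) j = (if j mod Suc n < n then t (j mod Suc n) else c)"
      unfolding word by (auto simp: A_def iter_def nth_append)
  qed
  have period: "(skew_tent \<alpha> \<beta> ^^ Suc n) \<beta> = \<beta>"
    using xn U_bounds[OF U] unfolding x_def by (simp add: skew_tent_def)
  have xmod: "x (j mod Suc n) = x j" for j
    unfolding x_def using funpow_mod_eq[OF period] .
  have at: "j mod Suc n = n" if "\<not> j mod Suc n < n" for j
    using that mod_less_divisor[of "Suc n" j] by linarith
  have hit: "x j = \<alpha> \<longleftrightarrow> \<not> j mod Suc n < n" for j
    using xmod[of j] at[of j] xn before[of "j mod Suc n"] t[of "j mod Suc n"]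
    by (cases "j mod Suc n < n") auto
  have orbit: "crit_orbit \<alpha> \<beta> j = x j" for j by (simp add: x_def)
  show ?thesis unfolding branch_coding_def orbit
  proof (intro conjI allI impI)
    fix j
    show "minus_seq (kneading \<alpha> \<beta>) j = L \<and> x j \<le> \<alpha> \<or> minus_seq (kneading \<alpha> \<beta>) j = R \<and> \<alpha> \<le> x j"
    proof (cases "j mod Suc n < n")
      case True
      then show ?thesis by (simp add: s t xmod hit)
    next
      case False
      then show ?thesis using hit[of j] by (simp add: s c_def)
    qed
  next
    fix i j
    assume "x i = \<alpha>" "x j = \<alpha>"
    then show "minus_seq (kneading \<alpha> \<beta>) i = minus_seq (kneading \<alpha> \<beta>) j"
      by (simp add: s hit)
  qed
qed

lemma branch_coding_cases:
  assumes "branch_coding \<alpha> \<beta> s"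
  shows "s j = L \<and> crit_orbit \<alpha> \<beta> j \<le> \<alpha> \<or> s j = R \<and> \<alpha> \<le> crit_orbit \<alpha> \<beta> j"
  using assms by (auto simp: branch_coding_def)

lemma branch_coding_L_step:
  assumes "branch_coding \<alpha> \<beta> s" "s j = L"
  shows "crit_orbit \<alpha> \<beta> (Suc j) = \<beta> / \<alpha> * crit_orbit \<alpha> \<beta> j"
  using branch_coding_cases[OF assms(1), of j] assms(2) by (auto simp: skew_tent_def)

lemma branch_coding_R_step:
  assumes "(\<alpha>, \<beta>) \<in> U" "branch_coding \<alpha> \<beta> s" "s j = R"
  shows "crit_orbit \<alpha> \<beta> (Suc j) = \<beta> / (1 - \<alpha>) * (1 - crit_orbit \<alpha> \<beta> j)"
  using branch_coding_cases[OF assms(2), of j] assms(3) skew_tent_right[OF assms(1)] by auto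

lemma branch_coding_L_run:
  assumes "branch_coding \<alpha> \<beta> s" "\<And>i. i < n \<Longrightarrow> s (j + i) = L"
  shows "crit_orbit \<alpha> \<beta> (j + n) = (\<beta> / \<alpha>) ^ n * crit_orbit \<alpha> \<beta> j"
  using assms(2)
proof (induction n)
  case (Suc n)
  then have "crit_orbit \<alpha> \<beta> (Suc (j + n)) = \<beta> / \<alpha> * crit_orbit \<alpha> \<beta> (j + n)"
    by (intro branch_coding_L_step[OF assms(1)]) simp
  then show ?case using Suc by simp
qed simp

lemma branch_coding_first_letters:
  assumes "(\<alpha>, \<beta>) \<in> U" "branch_coding \<alpha> \<beta> s"
  shows "s 0 = R" "s 1 = L"
  using branch_coding_cases[OF assms(2), of 0] branch_coding_cases[OF assms(2), of 1]
    U_bounds[OF assms(1)] crit_orbit_1_less[OF assms(1)] by auto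

text \<open>A tail without \<open>R\<close> would multiply a positive orbit point by \<open>\<beta> / \<alpha> > 1\<close> for ever.\<close>

lemma branch_coding_infinite_R:
  assumes U: "(\<alpha>, \<beta>) \<in> U" and "\<beta> < 1" and coding: "branch_coding \<alpha> \<beta> s"
  shows "infinite {n. s n = R}"
proof
  assume "finite {n. s n = R}"
  then obtain N where N: "\<And>n. s n = R \<Longrightarrow> n < N"
    using finite_nat_set_iff_bounded by auto
  have tail: "s (N + i) = L" for i
    using branch_coding_cases[OF coding, of "N + i"] N[of "N + i"] by auto
  note b = U_bounds[OF U]
  have pos: "0 < crit_orbit \<alpha> \<beta> N" using crit_orbit_pos[OF U \<open>\<beta> < 1\<close>] .
  have "1 < \<beta> / \<alpha>" using b by simp
  then obtain n where "1 / crit_orbit \<alpha> \<beta> N < (\<beta> / \<alpha>) ^ n"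
    using real_arch_pow by blast
  then have "1 < (\<beta> / \<alpha>) ^ n * crit_orbit \<alpha> \<beta> N"
    using pos by (simp add: field_simps)
  also have "\<dots> = crit_orbit \<alpha> \<beta> (N + n)"
    using branch_coding_L_run[OF coding, of n N] tail by simp
  finally show False using crit_orbit_range[OF U, of "N + n"] b by linarith
qed

section \<open>Runs of L between consecutive letters R\<close>

abbreviation R_pos :: "symbol word \<Rightarrow> nat \<Rightarrow> nat" where
  "R_pos s \<equiv> enumerate {n. s n = R}"

lemma R_pos_Suc:
  assumes "infinite {n. s n = R}"
  shows "R_pos s (Suc k) = Suc (R_pos s k + L_run s (Suc k))"
  using enumerate_step[OF assms, of k] by (simp add: L_run_def)

lemma letter_R_pos:
  assumes "infinite {n. s n = R}"
  shows "s (R_pos s k) = R"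
  using enumerate_in_set[OF assms, of k] by simp

lemma letter_in_L_run:
  assumes inf: "infinite {n. s n = R}" and LR: "\<And>j. s j = L \<or> s j = R" and "i < L_run s (Suc k)"
  shows "s (Suc (R_pos s k) + i) = L"
proof (rule ccontr)
  assume "s (Suc (R_pos s k) + i) \<noteq> L"
  then have "s (Suc (R_pos s k) + i) = R" using LR by blast
  then obtain l where l: "R_pos s l = Suc (R_pos s k) + i"
    using enumerate_Ex[OF inf, of "Suc (R_pos s k) + i"] by auto
  then have "R_pos s k < R_pos s l" "R_pos s l < R_pos s (Suc k)"
    using R_pos_Suc[OF inf, of k] assms(3) by auto
  then have "k < l" "l < Suc k" using inf by auto
  then show False by simp
qed

lemma R_pos_0:
  assumes "s 0 = R"
  shows "R_pos s 0 = 0"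
  using assms by (simp add: enumerate_0 Least_eq_0)

lemma L_run_1_pos:
  assumes inf: "infinite {n. s n = R}" and "s 0 = R" "s 1 = L"
  shows "0 < L_run s 1"
proof (rule ccontr)
  assume "\<not> 0 < L_run s 1"
  then have "R_pos s 1 = 1" using R_pos_Suc[OF inf, of 0] R_pos_0[of s, OF assms(2)] by simp
  then show False using letter_R_pos[OF inf, of 1] assms(3) by simp
qed

text \<open>Let \<open>m\<close> be the first run. After \<open>m\<close> letters \<open>L\<close> the orbit point \<open>x 1\<close> has left the open
  left side; a point that starts at \<open>x 1\<close> or above and reads more than \<open>m\<close> letters \<open>L\<close> must then
  sit, like \<open>x (m + 1)\<close>, on the turning point, contrary to the
  consistency of \<open>s\<close>: the letter would be \<open>R\<close> at \<open>x (m + 1)\<close> and \<open>L\<close> at the other visit.\<close>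

lemma L_run_le_first:
  assumes U: "(\<alpha>, \<beta>) \<in> U" and coding: "branch_coding \<alpha> \<beta> s" and inf: "infinite {n. s n = R}"
  shows "L_run s (Suc k) \<le> L_run s 1"
proof (rule ccontr)
  assume longer: "\<not> L_run s (Suc k) \<le> L_run s 1"
  let ?x = "crit_orbit \<alpha> \<beta>"
  define m where "m = L_run s 1"
  define j where "j = R_pos s k"
  note b = U_bounds[OF U]
  note cases = branch_coding_cases[OF coding]
  have LR: "s i = L \<or> s i = R" for i using cases[of i] by blast
  have e0: "R_pos s 0 = 0" using R_pos_0[of s, OF branch_coding_first_letters(1)[OF U coding]] .
  have first: "s (1 + i) = L" if "i < m" for i
    using letter_in_L_run[OF inf LR, of i 0] that e0 by (simp add: m_def)
  have later: "s (Suc j + i) = L" if "i \<le> m" for i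
    using letter_in_L_run[OF inf LR, of i k] that longer by (simp add: m_def j_def)
  have sR: "s (1 + m) = R"
    using letter_R_pos[OF inf, of 1] R_pos_Suc[OF inf, of 0] e0 by (simp add: m_def)
  have sL: "s (Suc j + m) = L" using later by simp
  have "?x 1 = \<beta> / (1 - \<alpha>) * (1 - \<beta>)"
    using branch_coding_R_step[OF U coding, of 0] branch_coding_first_letters(1)[OF U coding] by simp
  also have "\<dots> \<le> \<beta> / (1 - \<alpha>) * (1 - ?x j)"
    using crit_orbit_range[OF U, of j] b by (intro mult_left_mono) auto
  also have "\<dots> = ?x (Suc j)"
    using branch_coding_R_step[OF U coding, of j] letter_R_pos[OF inf, of k] by (simp add: j_def)
  finally have le: "?x 1 \<le> ?x (Suc j)" .
  have "?x (1 + m) = (\<beta> / \<alpha>) ^ m * ?x 1"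
    by (rule branch_coding_L_run[OF coding first])
  also have "\<dots> \<le> (\<beta> / \<alpha>) ^ m * ?x (Suc j)"
    using le b by (intro mult_left_mono) auto
  also have "\<dots> = ?x (Suc j + m)"
    using branch_coding_L_run[OF coding, of m "Suc j"] later by simp
  finally have "?x (1 + m) \<le> ?x (Suc j + m)" .
  moreover have "\<alpha> \<le> ?x (1 + m)" using cases[of "1 + m"] sR by auto
  moreover have "?x (Suc j + m) \<le> \<alpha>" using cases[of "Suc j + m"] sL by auto
  ultimately have "?x (1 + m) = \<alpha>" "?x (Suc j + m) = \<alpha>" by auto
  then have "s (1 + m) = s (Suc j + m)" using coding unfolding branch_coding_def by blast
  then show False using sR sL by simp
qed

lemma L_run_eventually_0:
  assumes inf: "infinite {n. s n = R}" and tail: "\<And>j. N \<le> j \<Longrightarrow> s j = R"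
    and LR: "\<And>j. s j = L \<or> s j = R" and "N \<le> k"
  shows "L_run s (Suc k) = 0"
proof (rule ccontr)
  assume "L_run s (Suc k) \<noteq> 0"
  then have "s (Suc (R_pos s k)) = L" using letter_in_L_run[OF inf LR, of 0 k] by simp
  moreover have "k \<le> R_pos s k" by (rule le_enumerate[OF inf])
  ultimately show False using tail[of "Suc (R_pos s k)"] \<open>N \<le> k\<close> by simp
qed

section \<open>The series\<close>

lemma mbar_Suc: "mbar M (Suc k) = mbar M k + L_run (minus_seq M) (Suc k)"
  by (simp add: mbar_def)

lemma Theta_term_alt: "Theta_term M \<alpha> \<beta> k = ((\<alpha> - 1) / \<beta>) ^ k * (\<alpha> / \<beta>) ^ mbar M k"
proof -
  have "(\<alpha> - 1) / \<beta> = - 1 * ((1 - \<alpha>) / \<beta>)" by (simp add: divide_simps)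
  then show ?thesis by (simp only: Theta_term_def power_mult_distrib)
qed

lemma Theta_term_bound:
  assumes "(\<alpha>, \<beta>) \<in> U"
  shows "\<bar>Theta_term M \<alpha> \<beta> k\<bar> \<le> ((1 - \<alpha>) / \<beta>) ^ k"
proof -
  note b = U_bounds[OF assms]
  have "(\<alpha> / \<beta>) ^ mbar M k \<le> 1" using b by (intro power_le_one) auto
  moreover have "0 \<le> ((1 - \<alpha>) / \<beta>) ^ k" using b by simp
  moreover have "\<bar>Theta_term M \<alpha> \<beta> k\<bar> = ((1 - \<alpha>) / \<beta>) ^ k * (\<alpha> / \<beta>) ^ mbar M k"
    using b by (simp add: Theta_term_def abs_mult power_abs)
  ultimately show ?thesis by (simp add: mult_left_le)
qed

lemma summable_Theta_term:
  assumes "(\<alpha>, \<beta>) \<in> U"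
  shows "summable (Theta_term M \<alpha> \<beta>)"
proof (rule summable_comparison_test')
  show "summable (\<lambda>k. ((1 - \<alpha>) / \<beta>) ^ k)"
    using U_bounds[OF assms] by (intro summable_geometric) simp
  show "norm (Theta_term M \<alpha> \<beta> k) \<le> ((1 - \<alpha>) / \<beta>) ^ k" if "0 \<le> k" for k
    using Theta_term_bound[OF assms] by simp
qed

text \<open>One block \<open>R L\<^sup>m\<close>, read backwards.\<close>

lemma crit_orbit_block:
  assumes U: "(\<alpha>, \<beta>) \<in> U" and coding: "branch_coding \<alpha> \<beta> s" and inf: "infinite {n. s n = R}"
  shows "crit_orbit \<alpha> \<beta> (R_pos s k) =
    1 - (1 - \<alpha>) / \<beta> * (\<alpha> / \<beta>) ^ L_run s (Suc k) * crit_orbit \<alpha> \<beta> (R_pos s (Suc k))"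
proof -
  let ?x = "crit_orbit \<alpha> \<beta>" and ?j = "R_pos s k" and ?m = "L_run s (Suc k)"
  note b = U_bounds[OF U]
  have LR: "s i = L \<or> s i = R" for i using branch_coding_cases[OF coding, of i] by blast
  have "?x (Suc ?j + ?m) = (\<beta> / \<alpha>) ^ ?m * ?x (Suc ?j)"
    by (rule branch_coding_L_run[OF coding letter_in_L_run[OF inf LR]])
  then have "(\<alpha> / \<beta>) ^ ?m * ?x (R_pos s (Suc k)) = (\<alpha> / \<beta> * (\<beta> / \<alpha>)) ^ ?m * ?x (Suc ?j)"
    by (simp only: R_pos_Suc[OF inf] power_mult_distrib add_Suc mult.assoc)
  also have "\<dots> = ?x (Suc ?j)" using b by simp
  also have "\<dots> = \<beta> / (1 - \<alpha>) * (1 - ?x ?j)"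
    by (rule branch_coding_R_step[OF U coding letter_R_pos[OF inf]])
  finally have "(1 - \<alpha>) / \<beta> * ((\<alpha> / \<beta>) ^ ?m * ?x (R_pos s (Suc k))) = 1 - ?x ?j"
    using b by simp
  then show ?thesis by (simp only: mult.assoc)
qed

text \<open>The remainder after \<open>n\<close> blocks is the \<open>n\<close>-th term of the series times an orbit point, hence
  tends to \<open>0\<close>.\<close>

lemma Theta_kneading_eq_0:
  assumes U: "(\<alpha>, \<beta>) \<in> U" and M: "kneading \<alpha> \<beta> = M"
    and inf: "infinite {n. minus_seq M n = R}"
  shows "Theta M \<alpha> \<beta> = 0"
proof -
  let ?T = "Theta_term M \<alpha> \<beta>"
  define s where "s = minus_seq M"
  define y where "y k = crit_orbit \<alpha> \<beta> (R_pos s k)" for k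
  have coding: "branch_coding \<alpha> \<beta> s" using branch_coding_kneading[OF U] M by (simp add: s_def)
  have inf_s: "infinite {n. s n = R}" using inf by (simp add: s_def)
  note b = U_bounds[OF U]
  have y0: "y 0 = \<beta>"
    by (simp add: y_def R_pos_0[of s, OF branch_coding_first_letters(1)[OF U coding]])
  have T0: "?T 0 = 1" by (simp add: Theta_term_def mbar_def)
  have TSuc: "?T (Suc k) = - ((1 - \<alpha>) / \<beta> * (\<alpha> / \<beta>) ^ L_run s (Suc k)) * ?T k" for k
    by (simp add: Theta_term_def mbar_Suc s_def power_add)
  have step: "?T k * y k = ?T k + ?T (Suc k) * y (Suc k)" for k
  proof -
    define q where "q = (1 - \<alpha>) / \<beta> * (\<alpha> / \<beta>) ^ L_run s (Suc k)"
    have y: "y k = 1 - q * y (Suc k)"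
      unfolding y_def q_def by (rule crit_orbit_block[OF U coding inf_s])
    have T: "?T (Suc k) = - q * ?T k" unfolding q_def by (rule TSuc)
    show ?thesis using y T by algebra
  qed
  have partial: "(\<Sum>k<n. ?T k) = \<beta> - ?T n * y n" for n
  proof (induction n)
    case 0
    then show ?case by (simp add: T0 y0)
  next
    case (Suc n)
    then show ?case using step[of n] by simp
  qed
  note summ = summable_Theta_term[OF U, of M]
  have "(\<lambda>n. ?T n * y n) \<longlonglongrightarrow> 0"
  proof (rule tendsto_0_le[OF summable_LIMSEQ_zero[OF summ], where K = 1])
    have "\<bar>y n\<bar> \<le> 1" for n
      using crit_orbit_range[OF U, of "R_pos s n"] b by (simp add: y_def)
    then show "\<forall>\<^sub>F n in sequentially. norm (?T n * y n) \<le> norm (?T n) * 1"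
      by (simp add: abs_mult mult_left_le)
  qed
  then have "(\<lambda>n. \<Sum>k<n. ?T k) \<longlonglongrightarrow> \<beta> - 0"
    unfolding partial by (intro tendsto_intros)
  then have "suminf ?T = \<beta>" using sums_unique[of ?T \<beta>] by (simp add: sums_def)
  then show ?thesis using suminf_split_head[OF summ] T0 by (simp add: Theta_def)
qed

section \<open>Kneading sequences other than R followed by L for ever\<close>

theorem theorem3:
  fixes M :: symbol_seq
  assumes "M \<in> kneading_seqs - {InfSeq ([R] \<frown> [L]\<^sup>\<omega>)}"
  shows "(\<forall>(\<alpha>, \<beta>) \<in> U. summable (\<lambda>k. Theta_term M \<alpha> \<beta> (Suc k))) \<and>
    (\<forall>(\<alpha>, \<beta>) \<in> U. kneading \<alpha> \<beta> = M \<longrightarrow> Theta M \<alpha> \<beta> = 0) \<and>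
    (\<forall>(\<alpha>, \<beta>) \<in> U.
       Theta M \<alpha> \<beta> =
         1 - \<beta> + (\<Sum>k. ((\<alpha> - 1) / \<beta>) ^ Suc k * (\<alpha> / \<beta>) ^ mbar M (Suc k))) \<and>
    L_run (minus_seq M) 1 = mbar M 1 \<and> mbar M 1 > 0 \<and>
    (\<forall>k. mbar M k \<le> mbar M (k + 1) \<and> mbar M (k + 1) \<le> mbar M k + mbar M 1) \<and>
    (\<forall>(\<alpha>, \<beta>) \<in> U. M = kneading \<alpha> \<beta> \<and> M \<in> kneading_seqs_Rinf \<longrightarrow>
       (\<exists>n. \<forall>k\<ge>n. mbar M (k + 1) = mbar M k))"
proof -
  let ?s = "minus_seq M"
  obtain \<gamma> where M: "M = kneading (1/2) \<gamma>" and \<gamma>: "1/2 < \<gamma>" "\<gamma> \<le> 1"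
    using assms by (auto simp: kneading_seqs_def)
  have U: "(1/2, \<gamma>) \<in> U" using \<gamma> by (simp add: U_def)
  have "\<gamma> \<noteq> 1" using assms M kneading_full_height[of "1/2"] U by auto
  then have "\<gamma> < 1" using \<gamma> by simp
  have coding: "branch_coding (1/2) \<gamma> ?s" using branch_coding_kneading[OF U] M by simp
  have LR: "?s j = L \<or> ?s j = R" for j using branch_coding_cases[OF coding, of j] by blast
  have inf: "infinite {n. ?s n = R}" by (rule branch_coding_infinite_R[OF U \<open>\<gamma> < 1\<close> coding])
  have m1: "L_run ?s 1 = mbar M 1" by (simp add: mbar_def)
  have m1_pos: "0 < mbar M 1"
    using L_run_1_pos[OF inf branch_coding_first_letters[OF U coding]] m1 by simp
  have m1_max: "mbar M (k + 1) \<le> mbar M k + mbar M 1" for k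
    using L_run_le_first[OF U coding inf, of k] m1 by (simp add: mbar_Suc)
  have const: "\<exists>n. \<forall>k\<ge>n. mbar M (k + 1) = mbar M k" if "M \<in> kneading_seqs_Rinf"
  proof -
    obtain A where "M = InfSeq (A \<frown> [R]\<^sup>\<omega>)"
      using \<open>M \<in> kneading_seqs_Rinf\<close> by (auto simp: kneading_seqs_Rinf_def)
    then have tail: "?s j = R" if "length A \<le> j" for j
      using that by (simp add: conc_def iter_def)
    show ?thesis
      using L_run_eventually_0[OF inf tail LR] by (auto simp: mbar_Suc)
  qed
  have summ: "summable (\<lambda>k. Theta_term M \<alpha> \<beta> (Suc k))" if "(\<alpha>, \<beta>) \<in> U" for \<alpha> \<beta>
    using summable_Theta_term[OF that, of M] unfolding summable_Suc_iff .
  have zero: "Theta M \<alpha> \<beta> = 0" if "(\<alpha>, \<beta>) \<in> U" "kneading \<alpha> \<beta> = M" for \<alpha> \<beta>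
    using Theta_kneading_eq_0[OF that inf] .
  have alt: "Theta M \<alpha> \<beta> =
      1 - \<beta> + (\<Sum>k. ((\<alpha> - 1) / \<beta>) ^ Suc k * (\<alpha> / \<beta>) ^ mbar M (Suc k))" for \<alpha> \<beta>
    unfolding Theta_def Theta_term_alt ..
  have mono: "mbar M k \<le> mbar M (k + 1)" for k by (simp add: mbar_Suc)
  show ?thesis
    by (intro conjI allI ballI case_prodI2)
      (use summ zero alt m1 m1_pos mono m1_max const in blast)+
qed

end
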